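(* Let $m,p,n$ be positive integers with $p\mid m$. The codimension atoms of $G(m,p,n)$ are exactly the reflections in $G(m,p,n)$ together with the $p$-connected elements of $G(m,p,n)$, excluding those $p$-connected elements $g$ with $\operatorname{codim}(g)=2$ and $\det(g)=1$.
   Context: $\zeta_m=e^{2\pi i/m}$. $G(m,1,n)$ is the group of $n\times n$ monomial matrices whose nonzero entries are $m$-th roots of unity, acting on $V=\mathbb{C}^n$; for $p\mid m$, $G(m,p,n)$ is the subgroup of elements whose nonzero entries multiply to an $(m/p)$-th root of unity. A reflection is an element of finite order fixing a hyperplane pointwise. $\operatorname{codim}(g)=n-\dim\{v\in V:gv=v\}$; the codimension order is $a\le_\perp c$ iff $\operatorname{codim}(a)+\operatorname{codim}(a^{-1}c)=\operatorname{codim}(c)$, and a codimension atom is an element covering the identity in this poset. A diagonal matrix $g\ne 1$ whose non-1 eigenvalues (with multiplicity) are $\zeta_m^{c_1},\dots,\zeta_m^{c_k}$ is $p$-connected if $p\mid c_1+\dots+c_k$ but $p\nmid\sum_{i\in I}c_i$ for every nonempty proper subset $I\subsetneq\{1,\dots,k\}$. *)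

theory Defs
  imports "HOL-Analysis.Analysis"
begin

text \<open>n is encoded as CARD('n) for a finite index type 'n; matrices are complex^'n^'n acting on V = complex^'n.\<close>

definition zeta :: "nat \<Rightarrow> complex" where
  "zeta m = cis (2 * pi / real m)"

text \<open>G(m,p,n): monomial matrices with m-th roots of unity as nonzero entries,
  whose nonzero entries multiply to an (m/p)-th root of unity.\<close>
definition Gmpn :: "nat \<Rightarrow> nat \<Rightarrow> (complex^'n^'n) set" where
  "Gmpn m p = {g. \<exists>\<sigma> c. \<sigma> permutes (UNIV :: 'n set) \<and>
      (\<forall>i j. g $ i $ j = (if i = \<sigma> j then c j else 0)) \<and>
      (\<forall>j. c j ^ m = 1) \<and>
      (\<Prod>j\<in>UNIV. c j) ^ (m div p) = 1}"

definition fixed_space :: "complex^'n^'n \<Rightarrow> (complex^'n) set" where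
  "fixed_space g = {v. g *v v = v}"

definition codim :: "complex^'n^'n \<Rightarrow> nat" where
  "codim g = CARD('n) - vec.dim (fixed_space g)"

text \<open>Codimension order a \<le>\<perp> c.\<close>
definition codim_le :: "complex^'n^'n \<Rightarrow> complex^'n^'n \<Rightarrow> bool" where
  "codim_le a c \<longleftrightarrow> codim a + codim (matrix_inv a ** c) = codim c"

text \<open>Codimension atom of a group W: an element covering the identity in (W, \<le>\<perp>).\<close>
definition codim_atom :: "(complex^'n^'n) set \<Rightarrow> complex^'n^'n \<Rightarrow> bool" where
  "codim_atom W a \<longleftrightarrow> a \<in> W \<and> a \<noteq> mat 1 \<and> codim_le (mat 1) a \<and>
     (\<forall>b\<in>W. codim_le (mat 1) b \<and> codim_le b a \<longrightarrow> b = mat 1 \<or> b = a)"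

text \<open>Reflection: finite order element fixing a hyperplane pointwise (non-identity).\<close>
definition reflection :: "complex^'n^'n \<Rightarrow> bool" where
  "reflection g \<longleftrightarrow> (\<exists>k>0. ((**) g ^^ k) (mat 1) = mat 1) \<and>
     (\<exists>H. vec.subspace H \<and> vec.dim H + 1 = CARD('n) \<and> (\<forall>v\<in>H. g *v v = v)) \<and>
     g \<noteq> mat 1"

definition diagonal :: "complex^'n^'n \<Rightarrow> bool" where
  "diagonal g \<longleftrightarrow> (\<forall>i j. i \<noteq> j \<longrightarrow> g $ i $ j = 0)"

text \<open>p-connected diagonal element: non-1 eigenvalues (diagonal entries, with multiplicity,
  indexed by their positions S) are zeta_m^(c_i), p divides the total sum but no nonempty
  proper partial sum.\<close>
definition p_connected :: "nat \<Rightarrow> nat \<Rightarrow> complex^'n^'n \<Rightarrow> bool" where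
  "p_connected m p g \<longleftrightarrow> diagonal g \<and> g \<noteq> mat 1 \<and>
     (let S = {i. g $ i $ i \<noteq> 1} in
       \<exists>c :: 'n \<Rightarrow> nat. (\<forall>i\<in>S. g $ i $ i = zeta m ^ c i) \<and>
         p dvd (\<Sum>i\<in>S. c i) \<and>
         (\<forall>I. I \<noteq> {} \<and> I \<subset> S \<longrightarrow> \<not> p dvd (\<Sum>i\<in>I. c i)))"

end

theory Submission
  imports Defs
begin

text \<open>Elements of G(m,p,n) are monomial matrices. Codimension is subadditive, so a \<le>\<perp> c
  means c = a h with codim a + codim h = codim c, and then Fix c = Fix a \<inter> Fix h and
  V = Fix a + Fix h. Codimension-one elements are therefore atoms, and they are exactly the
  reflections. A non-diagonal element with a e_j = c e_k (k \<noteq> j) lies above the reflection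
  exchanging e_j and c e_k; a diagonal element lies above its restriction to any set of nontrivial
  eigenvalues whose exponents sum to a multiple of p; and a diagonal element with exactly two
  nontrivial eigenvalues, of product one, lies above a transposition matrix. Conversely, if
  b \<le>\<perp> g with g diagonal, decomposing standard basis vectors along Fix b + Fix(b\<inverse>g) shows
  that b is trivial off the support of g, that its permutation is an involution whose
  transpositions (i j) satisfy g_ii g_jj = 1, and that its entries at fixed points are 1 or
  those of g. For p-connected g this leaves only b = 1, b = g, or codim g = 2 with det g = 1.\<close>

subsection \<open>Monomial matrices\<close>

definition monom :: "('n::finite \<Rightarrow> 'n) \<Rightarrow> ('n \<Rightarrow> 'a::semiring_1) \<Rightarrow> 'a^'n^'n" where
  "monom \<sigma> c = (\<chi> i j. if i = \<sigma> j then c j else 0)"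

lemma monom_nth [simp]: "monom \<sigma> c $ i $ j = (if i = \<sigma> j then c j else 0)"
  by (simp add: monom_def)

lemma mat_1_eq_monom: "mat 1 = monom id (\<lambda>_. 1)"
  by (simp add: vec_eq_iff mat_def)

lemma monom_mult: "monom \<sigma> c ** monom \<tau> e = monom (\<sigma> \<circ> \<tau>) (\<lambda>j. c (\<tau> j) * e j)"
proof -
  have "(\<Sum>k\<in>UNIV. (if i = \<sigma> k then c k else 0) * (if k = \<tau> j then e j else 0))
      = (\<Sum>k\<in>UNIV. if k = \<tau> j then (if i = \<sigma> k then c k else 0) * e j else 0)" for i j
    by (rule sum.cong) auto
  then show ?thesis
    by (simp add: vec_eq_iff matrix_matrix_mult_def)
qed

lemma monom_mult_vec_nth: "inj \<sigma> \<Longrightarrow> (monom \<sigma> c *v v) $ \<sigma> j = c j * v $ j"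
proof -
  assume "inj \<sigma>"
  then have "(\<Sum>k\<in>UNIV. (if \<sigma> j = \<sigma> k then c k else 0) * v $ k)
      = (\<Sum>k\<in>UNIV. if k = j then c k * v $ k else 0)"
    by (intro sum.cong) (auto simp: inj_eq)
  then show ?thesis
    by (simp add: matrix_vector_mult_def)
qed

lemma monom_mult_axis: "monom \<sigma> c *v axis j 1 = c j *s axis (\<sigma> j) 1"
proof -
  have "(\<Sum>l\<in>UNIV. (if i = \<sigma> l then c l else 0) * (if l = j then 1 else 0))
      = (\<Sum>l\<in>UNIV. if l = j then (if i = \<sigma> l then c l else 0) else 0)" for i
    by (rule sum.cong) auto
  then show ?thesis
    by (simp add: vec_eq_iff matrix_vector_mult_def axis_def)
qed

lemma invertible_monom:
  fixes c :: "'n::finite \<Rightarrow> 'a::field"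
  assumes "\<sigma> permutes UNIV" and "\<And>j. c j \<noteq> 0"
  shows "invertible (monom \<sigma> c)"
proof -
  have "\<sigma> \<circ> inv \<sigma> = id"
    using assms(1) permutes_inverses(1) by fastforce
  then have "monom \<sigma> c ** monom (inv \<sigma>) (\<lambda>j. inverse (c (inv \<sigma> j))) = mat 1"
    using assms(2) by (simp add: monom_mult mat_1_eq_monom)
  then show ?thesis
    using invertible_right_inverse by blast
qed

lemma fixed_space_monom_iff:
  assumes "\<sigma> permutes UNIV"
  shows "v \<in> fixed_space (monom \<sigma> c) \<longleftrightarrow> (\<forall>l. v $ \<sigma> l = c l * v $ l)"
proof -
  have "v \<in> fixed_space (monom \<sigma> c) \<longleftrightarrow> (\<forall>l. (monom \<sigma> c *v v) $ \<sigma> l = v $ \<sigma> l)"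
    using permutes_surj[OF assms] by (simp add: fixed_space_def vec_eq_iff) (metis surj_def)
  then show ?thesis
    by (auto simp: monom_mult_vec_nth[OF permutes_inj[OF assms]])
qed

subsection \<open>Codimension\<close>

lemma subspace_fixed_space: "vec.subspace (fixed_space g)"
  unfolding vec.subspace_def fixed_space_def
  by (auto simp: matrix_vector_right_distrib vec.scale)

lemma codim_mat_1 [simp]: "codim (mat 1 :: complex^'n^'n) = 0"
  by (simp add: codim_def fixed_space_def card_cart_basis)

lemma codim_eq_0_iff: "codim g = 0 \<longleftrightarrow> g = (mat 1 :: complex^'n^'n)"
proof
  assume "codim g = 0"
  then have "vec.dim (UNIV :: (complex^'n) set) \<le> vec.dim (fixed_space g)"
    by (simp add: codim_def card_cart_basis)
  then have "fixed_space g = UNIV"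
    using vec.subspace_dim_equal[OF subspace_fixed_space vec.subspace_UNIV] by blast
  then have "\<forall>v. g *v v = mat 1 *v v"
    by (auto simp: fixed_space_def)
  then show "g = mat 1"
    by (simp add: matrix_eq)
qed simp

lemma codim_less_if_fixed_space_psubset:
  assumes "fixed_space a \<subset> fixed_space (b :: complex^'n^'n)"
  shows "codim b < codim a"
proof -
  have "vec.span (fixed_space x) = fixed_space x" for x :: "complex^'n^'n"
    using subspace_fixed_space by (simp add: vec.span_eq_iff)
  then have "vec.dim (fixed_space a) < vec.dim (fixed_space b)"
    using assms vec.dim_psubset by metis
  then show ?thesis
    using dim_subset_UNIV_cart_gen[of "fixed_space b"] by (simp add: codim_def)
qed

lemma dim_fixed_spaces_sum_Int:
  fixes a b :: "complex^'n^'n"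
  shows "vec.dim {x + y |x y. x \<in> fixed_space a \<and> y \<in> fixed_space b}
      + vec.dim (fixed_space a \<inter> fixed_space b) = vec.dim (fixed_space a) + vec.dim (fixed_space b)"
  by (rule vec.dim_sums_Int[OF subspace_fixed_space subspace_fixed_space])

lemma fixed_space_Int_subset_mult: "fixed_space a \<inter> fixed_space b \<subseteq> fixed_space (a ** b)"
  by (auto simp: fixed_space_def matrix_vector_mul_assoc[symmetric])

lemma codim_mult_le: "codim (a ** b) \<le> codim a + codim (b :: complex^'n^'n)"
proof -
  have "vec.dim (fixed_space a \<inter> fixed_space b) \<le> vec.dim (fixed_space (a ** b))"
    using fixed_space_Int_subset_mult by (rule vec.dim_subset)
  then show ?thesis
    using dim_fixed_spaces_sum_Int[of a b]
      dim_subset_UNIV_cart_gen[of "{x + y |x y. x \<in> fixed_space a \<and> y \<in> fixed_space b}"]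
      dim_subset_UNIV_cart_gen[of "fixed_space a"] dim_subset_UNIV_cart_gen[of "fixed_space b"]
      dim_subset_UNIV_cart_gen[of "fixed_space (a ** b)"]
    by (simp add: codim_def)
qed

text \<open>When codimension is additive on a factorisation c = a h, both inequalities behind
  codim_mult_le are equalities.\<close>

lemma codim_additive_fixed_spaces:
  fixes a h :: "complex^'n^'n"
  assumes "a ** h = c" and "codim a + codim h = codim c"
  shows "fixed_space a \<inter> fixed_space h = fixed_space c"
    and "\<exists>x\<in>fixed_space a. \<exists>y\<in>fixed_space h. v = x + y"
proof -
  let ?S = "{x + y |x y. x \<in> fixed_space a \<and> y \<in> fixed_space h}"
  note dims = dim_fixed_spaces_sum_Int[of a h] dim_subset_UNIV_cart_gen[of ?S]
    dim_subset_UNIV_cart_gen[of "fixed_space a"] dim_subset_UNIV_cart_gen[of "fixed_space h"]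
    dim_subset_UNIV_cart_gen[of "fixed_space c"]
  have sub: "fixed_space a \<inter> fixed_space h \<subseteq> fixed_space c"
    using fixed_space_Int_subset_mult assms(1) by blast
  have "vec.dim (fixed_space c) \<le> vec.dim (fixed_space a \<inter> fixed_space h)"
    using dims assms(2) by (simp add: codim_def)
  then show Int: "fixed_space a \<inter> fixed_space h = fixed_space c"
    using vec.subspace_dim_equal[OF vec.subspace_inter subspace_fixed_space sub]
    by (simp add: subspace_fixed_space)
  have "vec.dim (UNIV :: (complex^'n) set) \<le> vec.dim ?S"
    using dims assms(2) Int by (simp add: codim_def card_cart_basis)
  then have "?S = UNIV"
    using vec.subspace_dim_equal[OF vec.subspace_sums[OF subspace_fixed_space subspace_fixed_space]
        vec.subspace_UNIV] by blast
  then show "\<exists>x\<in>fixed_space a. \<exists>y\<in>fixed_space h. v = x + y"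
    by blast
qed

lemma codim_diagonal:
  assumes "diagonal g"
  shows "codim g = card {i. g $ i $ i \<noteq> 1}"
proof -
  have "(g *v v) $ i = g $ i $ i * v $ i" for v i
  proof -
    have "(\<Sum>k\<in>UNIV. g $ i $ k * v $ k) = (\<Sum>k\<in>UNIV. if k = i then g $ i $ k * v $ k else 0)"
      using assms by (intro sum.cong) (auto simp: diagonal_def)
    then show ?thesis
      by (simp add: matrix_vector_mult_def)
  qed
  then have "fixed_space g = {x. \<forall>i. i \<notin> {i. g $ i $ i = 1} \<longrightarrow> x $ i = 0}"
    by (auto simp: fixed_space_def vec_eq_iff)
  then have "vec.dim (fixed_space g) = card {i. g $ i $ i = 1}"
    using dim_substandard_cart[of "{i. g $ i $ i = 1}"] by simp
  moreover have "{i. g $ i $ i \<noteq> 1} = UNIV - {i. g $ i $ i = 1}"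
    by auto
  ultimately show ?thesis
    by (simp add: codim_def card_Diff_subset)
qed

lemma det_diagonal_matrix: "diagonal g \<Longrightarrow> det g = (\<Prod>l\<in>UNIV. g $ l $ l)"
  unfolding diagonal_def by (rule det_diagonal) blast

subsection \<open>The codimension order\<close>

lemma matrix_inv_mult_cancel:
  fixes a :: "'a::field^'n^'n"
  assumes "invertible a"
  shows "matrix_inv a ** (a ** b) = b" and "a ** (matrix_inv a ** b) = b"
proof -
  have "a ** matrix_inv a = mat 1 \<and> matrix_inv a ** a = mat 1"
    using assms unfolding invertible_def matrix_inv_def by (rule someI_ex)
  then show "matrix_inv a ** (a ** b) = b" and "a ** (matrix_inv a ** b) = b"
    by (simp_all add: matrix_mul_assoc)
qed

lemma matrix_inv_involution:
  fixes a :: "'a::field^'n^'n"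
  assumes "a ** a = mat 1"
  shows "matrix_inv a = a"
proof -
  have "invertible a"
    using assms invertible_def by blast
  then show ?thesis
    using matrix_inv_mult_cancel(1)[of a a] assms by simp
qed

lemma codim_le_iff_factor:
  assumes "invertible b"
  shows "codim_le b a \<longleftrightarrow> (\<exists>h. b ** h = a \<and> codim b + codim h = codim a)"
  using matrix_inv_mult_cancel[OF assms] unfolding codim_le_def by metis

lemma codim_le_involution:
  assumes "b ** b = mat 1" and "codim b + codim (b ** a) \<le> codim a"
  shows "codim_le b a"
proof -
  have "b ** (b ** a) = a"
    using assms(1) by (simp add: matrix_mul_assoc)
  then have "codim a \<le> codim b + codim (b ** a)"
    using codim_mult_le by metis
  then show ?thesis
    using assms by (simp add: codim_le_def matrix_inv_involution)
qed

lemma codim_le_mat_1: "codim_le (mat 1) b"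
  by (simp add: codim_le_def matrix_inv_involution)

lemma not_codim_atom:
  "b \<in> W \<Longrightarrow> codim_le b a \<Longrightarrow> b \<noteq> mat 1 \<Longrightarrow> b \<noteq> a \<Longrightarrow> \<not> codim_atom W a"
  using codim_le_mat_1 unfolding codim_atom_def by blast

lemma codim_atomI:
  assumes "a \<in> W" "a \<noteq> mat 1" "\<And>b. b \<in> W \<Longrightarrow> codim_le b a \<Longrightarrow> b = mat 1 \<or> b = a"
  shows "codim_atom W a"
  using assms codim_le_mat_1 unfolding codim_atom_def by blast

lemma codim_1_codim_atom:
  assumes "a \<in> W" and "\<forall>b\<in>W. invertible b" and "codim a = 1"
  shows "codim_atom W a"
proof (rule codim_atomI)
  show "a \<noteq> mat 1"
    using assms(3) by auto
  fix b assume "b \<in> W" "codim_le b a"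
  then obtain h where h: "b ** h = a" "codim b + codim h = 1"
    using assms codim_le_iff_factor by metis
  then consider "codim b = 0" | "codim h = 0"
    by linarith
  then show "b = mat 1 \<or> b = a"
    by cases (use h in \<open>auto simp: codim_eq_0_iff\<close>)
qed fact

subsection \<open>Roots of unity\<close>

lemma zeta_power_exp:
  assumes "0 < m"
  shows "zeta m ^ j = exp (2 * of_real pi * \<i> * of_nat j / of_nat m)"
proof -
  have "zeta m ^ j = cis (real j * (2 * pi / real m))"
    unfolding zeta_def by (rule Complex.DeMoivre)
  also have "\<dots> = exp (2 * of_real pi * \<i> * of_nat j / of_nat m)"
    using assms by (simp add: cis_conv_exp field_simps)
  finally show ?thesis .
qed

lemma zeta_power_eq_1_iff: "0 < m \<Longrightarrow> zeta m ^ k = 1 \<longleftrightarrow> m dvd k"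
  using complex_root_unity_eq_1[of m k] by (simp add: zeta_power_exp)

lemma root_of_unity_is_zeta_power:
  assumes "0 < m" and "z ^ m = 1"
  shows "\<exists>k. z = zeta m ^ k"
  using complex_roots_unity[of m] assms by (auto simp: zeta_power_exp)

lemma zeta_power_power_div_eq_1_iff:
  assumes "0 < m" and "p dvd m"
  shows "(zeta m ^ k) ^ (m div p) = 1 \<longleftrightarrow> p dvd k"
proof -
  obtain q where q: "m = p * q" "0 < p" "0 < q"
    using assms by fastforce
  then have "(zeta m ^ k) ^ (m div p) = 1 \<longleftrightarrow> p * q dvd k * q"
    using zeta_power_eq_1_iff[OF assms(1)] by (simp add: power_mult[symmetric] mult.commute)
  then show ?thesis
    using q(3) by simp
qed

lemma prod_zeta_powers_power_div_eq_1_iff: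
  assumes "0 < m" and "p dvd m" and "\<forall>i\<in>I. d i = zeta m ^ c i"
  shows "(\<Prod>i\<in>I. d i) ^ (m div p) = 1 \<longleftrightarrow> p dvd (\<Sum>i\<in>I. c i)"
proof -
  have "(\<Prod>i\<in>I. d i) = zeta m ^ (\<Sum>i\<in>I. c i)"
    using assms(3) by (simp add: power_sum)
  then show ?thesis
    using zeta_power_power_div_eq_1_iff[OF assms(1,2)] by simp
qed

lemma nonzero_if_power_eq_1: "z ^ m = 1 \<Longrightarrow> 0 < m \<Longrightarrow> z \<noteq> (0::complex)"
  by (auto simp: power_0_left)

lemma prod_UNIV_eq_prod_support:
  fixes f :: "'n::finite \<Rightarrow> 'a::comm_monoid_mult"
  shows "(\<Prod>l\<in>UNIV. f l) = (\<Prod>l\<in>{l. f l \<noteq> 1}. f l)"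
  by (rule prod.mono_neutral_right) auto

subsection \<open>The group G(m,p,n)\<close>

lemma Gmpn_iff:
  "g \<in> Gmpn m p \<longleftrightarrow> (\<exists>\<sigma> c. \<sigma> permutes UNIV \<and> g = monom \<sigma> c \<and>
      (\<forall>j. c j ^ m = 1) \<and> (\<Prod>j\<in>UNIV. c j) ^ (m div p) = 1)"
  by (auto simp: Gmpn_def vec_eq_iff)

lemma monom_in_Gmpn:
  "\<sigma> permutes UNIV \<Longrightarrow> \<forall>j. c j ^ m = 1 \<Longrightarrow> (\<Prod>j\<in>UNIV. c j) ^ (m div p) = 1 \<Longrightarrow>
    monom \<sigma> c \<in> Gmpn m p"
  unfolding Gmpn_iff by blast

lemma mat_1_in_Gmpn: "mat 1 \<in> Gmpn m p"
  by (simp add: mat_1_eq_monom monom_in_Gmpn)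

lemma Gmpn_mult_closed:
  assumes "a \<in> Gmpn m p" and "b \<in> Gmpn m p"
  shows "a ** b \<in> Gmpn m p"
proof -
  obtain \<sigma> c \<tau> e where
    a: "\<sigma> permutes UNIV" "a = monom \<sigma> c" "\<forall>j. c j ^ m = 1" "(\<Prod>j\<in>UNIV. c j) ^ (m div p) = 1" and
    b: "\<tau> permutes UNIV" "b = monom \<tau> e" "\<forall>j. e j ^ m = 1" "(\<Prod>j\<in>UNIV. e j) ^ (m div p) = 1"
    using assms unfolding Gmpn_iff by metis
  have "(\<Prod>j\<in>UNIV. c (\<tau> j) * e j) = (\<Prod>j\<in>UNIV. c j) * (\<Prod>j\<in>UNIV. e j)"
    using prod.permute[OF b(1), of c] by (simp add: prod.distrib)
  then show ?thesis
    using a b by (auto simp: monom_mult power_mult_distrib intro!: monom_in_Gmpn permutes_compose)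
qed

lemma invertible_Gmpn: "g \<in> Gmpn m p \<Longrightarrow> 0 < m \<Longrightarrow> invertible g"
  unfolding Gmpn_iff using invertible_monom nonzero_if_power_eq_1 by metis

lemma finite_Gmpn:
  assumes "0 < m"
  shows "finite (Gmpn m p :: (complex^'n^'n) set)"
proof -
  let ?R = "insert 0 {z::complex. z ^ m = 1}"
  let ?Q = "{A::complex^'n^'n. \<forall>i j. A $ i $ j \<in> ?R}"
  let ?entries = "\<lambda>A::complex^'n^'n. \<lambda>ij::'n \<times> 'n. A $ fst ij $ snd ij"
  have "?entries ` ?Q \<subseteq> PiE UNIV (\<lambda>_. ?R)"
    by (auto simp: PiE_UNIV_domain)
  moreover have "finite (PiE (UNIV :: ('n \<times> 'n) set) (\<lambda>_. ?R))"
    using assms by (intro finite_PiE) (auto simp: finite_roots_unity)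
  ultimately have "finite (?entries ` ?Q)"
    by (rule finite_subset)
  moreover have "inj_on ?entries ?Q"
    by (auto simp: inj_on_def vec_eq_iff fun_eq_iff)
  ultimately have "finite ?Q"
    using finite_image_iff by blast
  moreover have "Gmpn m p \<subseteq> ?Q"
  proof
    fix g :: "complex^'n^'n" assume "g \<in> Gmpn m p"
    then obtain \<sigma> c where "\<forall>i j. g $ i $ j = (if i = \<sigma> j then c j else 0)" "\<forall>j. c j ^ m = 1"
      unfolding Gmpn_def by blast
    then show "g \<in> ?Q"
      by simp
  qed
  ultimately show ?thesis
    by (rule finite_subset[rotated])
qed

lemma matrix_power_add:
  "((**) g ^^ (k + l)) (mat 1) = ((**) g ^^ k) (mat 1) ** ((**) g ^^ l) (mat 1)"
  for g :: "'a::semiring_1^'n^'n"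
  by (induction k) (simp_all add: matrix_mul_assoc)

lemma finite_order_Gmpn:
  assumes "g \<in> Gmpn m p" and "0 < m"
  shows "\<exists>k>0. ((**) g ^^ k) (mat 1) = (mat 1 :: complex^'n^'n)"
proof -
  let ?pow = "\<lambda>k. ((**) g ^^ k) (mat 1)"
  have pow_in: "?pow k \<in> Gmpn m p" for k
  proof (induction k)
    case (Suc k)
    then show ?case
      using Gmpn_mult_closed[OF assms(1)] by simp
  qed (simp add: mat_1_in_Gmpn)
  then have "finite (range ?pow)"
    by (intro finite_subset[OF _ finite_Gmpn[OF assms(2)]]) auto
  then have "\<not> inj ?pow"
    using finite_imageD[of ?pow UNIV] by auto
  then obtain k l where kl: "k < l" "?pow l = ?pow k"
    unfolding inj_on_def by (metis linorder_neqE_nat)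
  obtain Q where Q: "?pow k ** Q = mat 1"
    using invertible_Gmpn[OF pow_in assms(2)] invertible_right_inverse by blast
  have "?pow (l - k) = ?pow (l - k) ** (?pow k ** Q)"
    using Q by simp
  also have "\<dots> = ?pow l ** Q"
    using matrix_power_add[of "l - k" k g] kl(1) by (simp add: matrix_mul_assoc)
  finally have "?pow (l - k) = mat 1"
    using kl(2) Q by simp
  then show ?thesis
    using kl(1) zero_less_diff by blast
qed

lemma diagonal_Gmpn:
  assumes "a \<in> Gmpn m p" and "0 < m" and "diagonal a"
  shows "a = monom id (\<lambda>l. a $ l $ l)" and "\<forall>l. (a $ l $ l) ^ m = 1"
    and "(\<Prod>l\<in>UNIV. a $ l $ l) ^ (m div p) = 1"
proof -
  obtain \<sigma> c where a: "a = monom \<sigma> c" "\<forall>j. c j ^ m = 1" "(\<Prod>j\<in>UNIV. c j) ^ (m div p) = 1"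
    using assms(1) unfolding Gmpn_iff by blast
  have "\<sigma> l = l" for l
  proof (rule ccontr)
    assume "\<sigma> l \<noteq> l"
    then have "c l = 0"
      using assms(3) a(1) unfolding diagonal_def by (metis monom_nth)
    then show False
      using nonzero_if_power_eq_1 a(2) assms(2) by blast
  qed
  then have "\<sigma> = id" and "c = (\<lambda>l. a $ l $ l)"
    using a(1) by (auto simp: fun_eq_iff)
  then show "a = monom id (\<lambda>l. a $ l $ l)" "\<forall>l. (a $ l $ l) ^ m = 1"
    "(\<Prod>l\<in>UNIV. a $ l $ l) ^ (m div p) = 1"
    using a by simp_all
qed

subsection \<open>Reflections\<close>

lemma reflection_codim_1:
  fixes g :: "complex^'n^'n"
  assumes "reflection g"
  shows "codim g = 1"
proof -
  obtain H where H: "vec.dim H + 1 = CARD('n)" "\<forall>v\<in>H. g *v v = v"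
    using assms unfolding reflection_def by blast
  have "H \<subseteq> fixed_space g"
    using H(2) by (auto simp: fixed_space_def)
  then have "vec.dim H \<le> vec.dim (fixed_space g)"
    by (rule vec.dim_subset)
  then have "codim g \<le> 1"
    using H(1) by (simp add: codim_def)
  moreover have "codim g \<noteq> 0"
    using assms codim_eq_0_iff unfolding reflection_def by blast
  ultimately show ?thesis
    by linarith
qed

lemma codim_1_reflection:
  fixes g :: "complex^'n^'n"
  assumes "g \<in> Gmpn m p" and "0 < m" and "codim g = 1"
  shows "reflection g"
  unfolding reflection_def
proof (intro conjI)
  show "\<exists>k>0. ((**) g ^^ k) (mat 1) = mat 1"
    using assms(1,2) by (rule finite_order_Gmpn)
  have "vec.dim (fixed_space g) + 1 = CARD('n)"
    using assms(3) dim_subset_UNIV_cart_gen[of "fixed_space g"] by (simp add: codim_def)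
  then show "\<exists>H. vec.subspace H \<and> vec.dim H + 1 = CARD('n) \<and> (\<forall>v\<in>H. g *v v = v)"
    using subspace_fixed_space[of g] by (auto simp: fixed_space_def)
  show "g \<noteq> mat 1"
    using assms(3) by auto
qed

text \<open>The reflection sending e_j to z e_k and e_k to z^-1 e_j.\<close>

definition swap_matrix :: "'n::finite \<Rightarrow> 'n \<Rightarrow> complex \<Rightarrow> complex^'n^'n" where
  "swap_matrix j k z =
     monom (Transposition.transpose j k) (\<lambda>l. if l = j then z else if l = k then inverse z else 1)"

lemma swap_matrix_involution:
  assumes "j \<noteq> k" and "z \<noteq> 0"
  shows "swap_matrix j k z ** swap_matrix j k z = mat 1"
proof -
  let ?e = "\<lambda>l. if l = j then z else if l = k then inverse z else 1"
  have "Transposition.transpose j k \<circ> Transposition.transpose j k = id"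
    by (simp add: fun_eq_iff)
  moreover have "(\<lambda>l. ?e (Transposition.transpose j k l) * ?e l) = (\<lambda>_. 1)"
    using assms by (auto simp: fun_eq_iff Transposition.transpose_def)
  ultimately show ?thesis
    by (simp add: swap_matrix_def monom_mult mat_1_eq_monom)
qed

lemma fixed_space_swap_matrix_iff:
  assumes "j \<noteq> k" and "z \<noteq> 0"
  shows "v \<in> fixed_space (swap_matrix j k z) \<longleftrightarrow> v $ k = z * v $ j"
proof -
  have "v \<in> fixed_space (swap_matrix j k z) \<longleftrightarrow>
      (\<forall>l. v $ Transposition.transpose j k l = (if l = j then z else if l = k then inverse z else 1) * v $ l)"
    unfolding swap_matrix_def by (rule fixed_space_monom_iff) (simp add: permutes_swap_id)
  also have "\<dots> \<longleftrightarrow> v $ k = z * v $ j"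
  proof
    assume "\<forall>l. v $ Transposition.transpose j k l =
        (if l = j then z else if l = k then inverse z else 1) * v $ l"
    then show "v $ k = z * v $ j"
      by (metis transpose_apply_first)
  next
    assume "v $ k = z * v $ j"
    then show "\<forall>l. v $ Transposition.transpose j k l =
        (if l = j then z else if l = k then inverse z else 1) * v $ l"
      using assms by (auto simp: Transposition.transpose_def)
  qed
  finally show ?thesis .
qed

lemma codim_swap_matrix_le_1:
  fixes j k :: "'n::finite"
  assumes "j \<noteq> k" and "z \<noteq> 0"
  shows "codim (swap_matrix j k z) \<le> 1"
proof -
  let ?Z = "{x::complex^'n. \<forall>i. i \<notin> UNIV - {j, k} \<longrightarrow> x $ i = 0}"
  let ?u = "axis j 1 + z *s axis k 1 :: complex^'n"
  have "card {j, k} \<le> CARD('n)" and "card {j, k} = 2"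
    using assms(1) card_mono[of UNIV "{j, k}"] by auto
  moreover have "vec.dim ?Z = card (UNIV - {j, k})"
    by (rule dim_substandard_cart)
  ultimately have dim_Z: "vec.dim ?Z + 2 = CARD('n)"
    by (simp add: card_Diff_subset)
  have "vec.span ?Z = ?Z"
    by (rule vec.span_eq_iff[THEN iffD2]) (rule subspace_substandard_cart)
  moreover have "?u \<notin> ?Z"
    using assms(1) by (auto simp: axis_def)
  ultimately have "?u \<notin> vec.span ?Z"
    by (simp only: not_False_eq_True)
  then have "vec.dim (insert ?u ?Z) = vec.dim ?Z + 1"
    by (simp only: vec.dim_insert if_False)
  moreover have "insert ?u ?Z \<subseteq> fixed_space (swap_matrix j k z)"
    using assms by (auto simp: fixed_space_swap_matrix_iff axis_def)
  then have "vec.dim (insert ?u ?Z) \<le> vec.dim (fixed_space (swap_matrix j k z))"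
    by (rule vec.dim_subset)
  ultimately show ?thesis
    using dim_Z unfolding codim_def by linarith
qed

lemma swap_matrix_in_Gmpn:
  assumes "j \<noteq> k" and "z ^ m = 1" and "0 < m"
  shows "swap_matrix j k z \<in> Gmpn m p"
proof -
  have "z \<noteq> 0"
    using assms nonzero_if_power_eq_1 by blast
  have "(\<Prod>l\<in>UNIV. if l = j then z else if l = k then inverse z else 1)
      = (\<Prod>l\<in>{j, k}. if l = j then z else if l = k then inverse z else 1)"
    by (intro prod.mono_neutral_right) auto
  then have "(\<Prod>l\<in>UNIV. if l = j then z else if l = k then inverse z else 1) = 1"
    using assms(1) \<open>z \<noteq> 0\<close> by simp
  then show ?thesis
    unfolding swap_matrix_def using assms(2)
    by (intro monom_in_Gmpn) (auto simp: permutes_swap_id power_inverse)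
qed

lemma swap_matrix_neq_mat_1: "j \<noteq> k \<Longrightarrow> swap_matrix j k z \<noteq> mat 1"
  by (auto simp: swap_matrix_def vec_eq_iff mat_def Transposition.transpose_def)

subsection \<open>Atoms are reflections or p-connected\<close>

lemma nondiagonal_not_codim_atom:
  assumes "a \<in> Gmpn m p" and "0 < m" and "\<not> diagonal a" and "2 \<le> codim a"
  shows "\<not> codim_atom (Gmpn m p) a"
proof -
  obtain \<sigma> c where a: "a = monom \<sigma> c" "\<sigma> permutes UNIV" "\<forall>j. c j ^ m = 1"
    using assms(1) unfolding Gmpn_iff by blast
  obtain j where "\<sigma> j \<noteq> j"
    using assms(3) a(1) unfolding diagonal_def by (metis monom_nth)
  define k where "k = \<sigma> j"
  define r where "r = swap_matrix j k (c j)"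
  have jk: "j \<noteq> k" and cj: "c j \<noteq> 0"
    using \<open>\<sigma> j \<noteq> j\<close> a(3) assms(2) nonzero_if_power_eq_1 by (auto simp: k_def)
  have a_axis: "a *v axis j 1 = c j *s axis k 1"
    by (simp add: a(1) monom_mult_axis k_def)
  have "r *v axis k 1 = inverse (c j) *s axis j 1"
    using jk by (simp add: r_def swap_matrix_def monom_mult_axis)
  then have "axis j 1 \<in> fixed_space (r ** a)"
    using a_axis cj by (simp add: fixed_space_def matrix_vector_mul_assoc[symmetric] vec.scale)
  moreover have "axis j 1 \<notin> fixed_space a"
    using a_axis jk by (auto simp: fixed_space_def vec_eq_iff axis_def)
  moreover have "fixed_space a \<subseteq> fixed_space r"
    using jk cj by (auto simp: r_def fixed_space_swap_matrix_iff fixed_space_monom_iff[OF a(2)]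
        a(1) k_def)
  then have "fixed_space a \<subseteq> fixed_space (r ** a)"
    using fixed_space_Int_subset_mult[of r a] by blast
  ultimately have "codim (r ** a) < codim a"
    by (intro codim_less_if_fixed_space_psubset) blast
  moreover have "codim r \<le> 1"
    unfolding r_def using jk cj by (rule codim_swap_matrix_le_1)
  ultimately have "codim_le r a"
    using jk cj by (intro codim_le_involution) (simp_all add: r_def swap_matrix_involution)
  moreover have "r \<in> Gmpn m p"
    using jk a(3) assms(2) by (simp add: r_def swap_matrix_in_Gmpn)
  moreover have "r \<noteq> a"
    using \<open>codim r \<le> 1\<close> assms(4) by auto
  ultimately show ?thesis
    using jk by (intro not_codim_atom) (simp_all add: r_def swap_matrix_neq_mat_1)
qed

lemma diagonal_split_not_codim_atom:
  assumes "a \<in> Gmpn m p" and "0 < m" and "diagonal a"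
    and "I \<noteq> {}" and "I \<subset> {l. a $ l $ l \<noteq> 1}" and "(\<Prod>l\<in>I. a $ l $ l) ^ (m div p) = 1"
  shows "\<not> codim_atom (Gmpn m p) a"
proof -
  define S where "S = {l. a $ l $ l \<noteq> 1}"
  define b where "b = monom id (\<lambda>l. if l \<in> I then a $ l $ l else 1)"
  define h where "h = monom id (\<lambda>l. if l \<in> I then 1 else a $ l $ l)"
  note a = diagonal_Gmpn[OF assms(1-3)]
  have "b ** h = monom id (\<lambda>l. a $ l $ l)"
    by (simp add: b_def h_def monom_mult vec_eq_iff)
  then have bh: "b ** h = a"
    using a(1) by simp
  have "(\<Prod>l\<in>UNIV. if l \<in> I then a $ l $ l else 1) = (\<Prod>l\<in>I. a $ l $ l)"
    by (simp add: prod.If_cases)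
  then have "b \<in> Gmpn m p"
    unfolding b_def using a(2) assms(6) by (intro monom_in_Gmpn) auto
  moreover have "codim b + codim h = codim a"
  proof -
    have "{l. b $ l $ l \<noteq> 1} = I" and "{l. h $ l $ l \<noteq> 1} = S - I"
      using assms(5) by (auto simp: b_def h_def S_def)
    then have "codim b = card I" and "codim h = card (S - I)"
      by (simp_all add: codim_diagonal diagonal_def b_def h_def)
    moreover have "codim a = card S"
      using codim_diagonal[OF assms(3)] by (simp add: S_def)
    ultimately show ?thesis
      using assms(5) by (simp add: S_def card_Diff_subset card_mono)
  qed
  then have "codim_le b a"
    using bh invertible_Gmpn[OF \<open>b \<in> Gmpn m p\<close> assms(2)] codim_le_iff_factor by blast
  moreover obtain i i' where "i \<in> I" and "i' \<in> S - I"
    using assms(4,5) by (auto simp: S_def)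
  then have "b \<noteq> mat 1" and "b \<noteq> a"
    using assms(5) by (auto simp: b_def S_def vec_eq_iff mat_def dest!: spec[of _ i] spec[of _ i'])
  ultimately show ?thesis
    by (rule not_codim_atom)
qed

lemma diagonal_codim_2_det_1_not_codim_atom:
  assumes "a \<in> Gmpn m p" and "0 < m" and "diagonal a"
    and "{l. a $ l $ l \<noteq> 1} = {i, j}" and "i \<noteq> j" and "a $ i $ i * a $ j $ j = 1"
  shows "\<not> codim_atom (Gmpn m p) a"
proof -
  define b where "b = swap_matrix i j 1"
  note a = diagonal_Gmpn[OF assms(1-3)]
  have ai: "a $ i $ i \<noteq> 0"
    using assms(6) by auto
  have aj: "a $ j $ j = inverse (a $ i $ i)"
    using inverse_unique[OF assms(6)] by simp
  have "b ** monom id (\<lambda>l. a $ l $ l) = monom (Transposition.transpose i j) (\<lambda>l. a $ l $ l)"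
    by (simp add: b_def swap_matrix_def monom_mult cong: if_cong)
  then have "b ** a = monom (Transposition.transpose i j) (\<lambda>l. a $ l $ l)"
    using a(1) by simp
  also have "(\<lambda>l. a $ l $ l) = (\<lambda>l. if l = i then a $ i $ i else if l = j then inverse (a $ i $ i) else 1)"
    using assms(4) aj by (auto simp: fun_eq_iff)
  finally have "b ** a = swap_matrix i j (a $ i $ i)"
    by (simp only: swap_matrix_def)
  then have "codim (b ** a) \<le> 1"
    using codim_swap_matrix_le_1[OF assms(5) ai] by simp
  moreover have "codim a = 2"
    using codim_diagonal[OF assms(3)] assms(4,5) by simp
  ultimately have "codim_le b a"
    using codim_swap_matrix_le_1[OF assms(5), of 1] swap_matrix_involution[OF assms(5), of 1]
    by (intro codim_le_involution) (simp_all add: b_def)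
  moreover have "b \<noteq> a"
    using assms(3,5) by (auto simp: b_def swap_matrix_def diagonal_def vec_eq_iff dest!: spec[of _ j])
  moreover have "b \<in> Gmpn m p"
    unfolding b_def using assms(2,5) by (simp add: swap_matrix_in_Gmpn)
  ultimately show ?thesis
    using assms(5) by (intro not_codim_atom) (simp_all add: b_def swap_matrix_neq_mat_1)
qed

lemma diagonal_codim_atom_p_connected:
  assumes "0 < m" and "p dvd m" and "codim_atom (Gmpn m p) a" and "diagonal a"
  shows "p_connected m p a"
proof -
  define S where "S = {l. a $ l $ l \<noteq> 1}"
  have a: "a \<in> Gmpn m p" "a \<noteq> mat 1"
    using assms(3) by (auto simp: codim_atom_def)
  note diag = diagonal_Gmpn[OF a(1) assms(1,4)]
  have "\<forall>l. \<exists>k. a $ l $ l = zeta m ^ k"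
    using diag(2) root_of_unity_is_zeta_power[OF assms(1)] by blast
  then have "\<exists>c. \<forall>l. a $ l $ l = zeta m ^ c l"
    by (rule choice)
  then obtain c where c: "\<And>l. a $ l $ l = zeta m ^ c l"
    by blast
  have dvd_iff: "(\<Prod>l\<in>I. a $ l $ l) ^ (m div p) = 1 \<longleftrightarrow> p dvd (\<Sum>l\<in>I. c l)" for I
    using c by (intro prod_zeta_powers_power_div_eq_1_iff[OF assms(1,2)]) simp
  have "p dvd (\<Sum>l\<in>S. c l)"
    using diag(3) dvd_iff prod_UNIV_eq_prod_support[of "\<lambda>l. a $ l $ l"] by (simp add: S_def)
  moreover have "\<not> p dvd (\<Sum>l\<in>I. c l)" if "I \<noteq> {}" and "I \<subset> S" for I
    using diagonal_split_not_codim_atom[OF a(1) assms(1,4) that[unfolded S_def]] assms(3) dvd_iff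
    by blast
  ultimately show ?thesis
    unfolding p_connected_def Let_def S_def[symmetric] using assms(4) a(2) c by blast
qed

lemma diagonal_codim_atom_codim_2_det_neq_1:
  assumes "0 < m" and "codim_atom (Gmpn m p) a" and "diagonal a" and "codim a = 2"
  shows "det a \<noteq> 1"
proof
  assume det: "det a = 1"
  have "card {l. a $ l $ l \<noteq> 1} = 2"
    using codim_diagonal[OF assms(3)] assms(4) by simp
  then obtain i j where ij: "{l. a $ l $ l \<noteq> 1} = {i, j}" "i \<noteq> j"
    by (auto simp: card_2_iff)
  have "a $ i $ i * a $ j $ j = 1"
    using det det_diagonal_matrix[OF assms(3)] ij prod_UNIV_eq_prod_support[of "\<lambda>l. a $ l $ l"]
    by simp
  then show False
    using diagonal_codim_2_det_1_not_codim_atom[OF _ assms(1,3) ij] assms(2)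
    by (auto simp: codim_atom_def)
qed

lemma codim_atom_Gmpn_cases:
  assumes "0 < m" and "p dvd m" and "codim_atom (Gmpn m p) a"
  shows "reflection a \<or> (p_connected m p a \<and> \<not> (codim a = 2 \<and> det a = 1))"
proof -
  have a: "a \<in> Gmpn m p" "a \<noteq> mat 1"
    using assms(3) by (auto simp: codim_atom_def)
  have "codim a \<noteq> 0"
    using a(2) codim_eq_0_iff by blast
  then consider "codim a = 1" | "2 \<le> codim a"
    by linarith
  then show ?thesis
  proof cases
    case 1
    then show ?thesis
      using codim_1_reflection[OF a(1) assms(1)] by blast
  next
    case 2
    then have diag: "diagonal a"
      using nondiagonal_not_codim_atom[OF a(1) assms(1) _ 2] assms(3) by blast
    have "\<not> (codim a = 2 \<and> det a = 1)"
      using diagonal_codim_atom_codim_2_det_neq_1[OF assms(1,3) diag] by blast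
    then show ?thesis
      using diagonal_codim_atom_p_connected[OF assms diag] by blast
  qed
qed

subsection \<open>p-connected elements are atoms\<close>

text \<open>Each lemma below decomposes a standard basis vector along V = Fix b + Fix(b\<inverse>g),
  for b = monom \<sigma> \<beta> and g = monom id d, and compares coordinates.\<close>

locale monomial_below_diagonal =
  fixes d \<beta> :: "'n::finite \<Rightarrow> complex" and \<sigma> :: "'n \<Rightarrow> 'n"
  assumes permutes: "\<sigma> permutes UNIV"
    and d_nonzero: "\<And>l. d l \<noteq> 0"
    and \<beta>_nonzero: "\<And>l. \<beta> l \<noteq> 0"
    and below: "codim_le (monom \<sigma> \<beta>) (monom id d)"
begin

lemma factorisation:
  obtains h where "monom \<sigma> \<beta> ** h = monom id d"
    and "codim (monom \<sigma> \<beta>) + codim h = codim (monom id d)"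
  using codim_le_iff_factor[OF invertible_monom[OF permutes \<beta>_nonzero], THEN iffD1, OF below]
    that by blast

lemma decomposition:
  obtains x y where "v = x + y" and "\<And>l. x $ \<sigma> l = \<beta> l * x $ l"
    and "\<And>l. \<beta> l * y $ l = d (\<sigma> l) * y $ \<sigma> l"
proof -
  obtain h where h: "monom \<sigma> \<beta> ** h = monom id d"
      "codim (monom \<sigma> \<beta>) + codim h = codim (monom id d)"
    by (rule factorisation)
  then obtain x y where xy: "x \<in> fixed_space (monom \<sigma> \<beta>)" "y \<in> fixed_space h" "v = x + y"
    using codim_additive_fixed_spaces(2)[OF h, of v] by blast
  have "monom id d *v y = monom \<sigma> \<beta> *v (h *v y)"
    using h(1) by (simp add: matrix_vector_mul_assoc)
  also have "h *v y = y"
    using xy(2) by (simp add: fixed_space_def)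
  finally have "\<beta> l * y $ l = d (\<sigma> l) * y $ \<sigma> l" for l
    using monom_mult_vec_nth[OF permutes_inj[OF permutes], of \<beta> y l]
      monom_mult_vec_nth[OF inj_on_id, of d y "\<sigma> l"] by (simp add: id_def)
  moreover have "x $ \<sigma> l = \<beta> l * x $ l" for l
    using xy(1) fixed_space_monom_iff[OF permutes] by blast
  ultimately show ?thesis
    using that[OF xy(3)] by blast
qed

lemma fixed_outside_support:
  assumes "d j = 1"
  shows "\<sigma> j = j" and "\<beta> j = 1"
proof -
  obtain h where h: "monom \<sigma> \<beta> ** h = monom id d"
      "codim (monom \<sigma> \<beta>) + codim h = codim (monom id d)"
    by (rule factorisation)
  have "axis j 1 \<in> fixed_space (monom id d)"
    using assms by (simp add: fixed_space_def monom_mult_axis)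
  then have "axis j 1 \<in> fixed_space (monom \<sigma> \<beta>)"
    using codim_additive_fixed_spaces(1)[OF h] by blast
  then have "(axis j 1 :: complex^'n) $ \<sigma> j = \<beta> j"
    using fixed_space_monom_iff[OF permutes] by (simp add: axis_def)
  then show "\<sigma> j = j" and "\<beta> j = 1"
    using \<beta>_nonzero[of j] by (auto simp: axis_def split: if_splits)
qed

lemma fixed_point_entry:
  assumes "\<sigma> i = i"
  shows "\<beta> i = 1 \<or> \<beta> i = d i"
proof (rule ccontr)
  assume ne: "\<not> (\<beta> i = 1 \<or> \<beta> i = d i)"
  obtain x y where xy: "axis i 1 = x + y" "\<And>l. x $ \<sigma> l = \<beta> l * x $ l"
      "\<And>l. \<beta> l * y $ l = d (\<sigma> l) * y $ \<sigma> l"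
    using decomposition[of "axis i 1"] by blast
  have "x $ i = 0"
    using xy(2)[of i] assms ne by (metis mult_cancel_right1)
  moreover have "y $ i = 0"
    using xy(3)[of i] assms ne by simp
  moreover have "x $ i + y $ i = 1"
    using arg_cong[OF xy(1), of "\<lambda>v. v $ i"] by (simp add: axis_def)
  ultimately show False
    by simp
qed

lemma two_cycle:
  assumes "\<sigma> i = j" and "\<sigma> j = i" and "i \<noteq> j"
  shows "d i * d j = 1"
proof -
  obtain x y where xy: "axis j 1 = x + y" "\<And>l. x $ \<sigma> l = \<beta> l * x $ l"
      "\<And>l. \<beta> l * y $ l = d (\<sigma> l) * y $ \<sigma> l"
    using decomposition[of "axis j 1"] by blast
  have x: "x $ j = \<beta> i * x $ i" "x $ i = \<beta> j * x $ j"
    using xy(2)[of i] xy(2)[of j] assms by simp_all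
  have y: "\<beta> i * y $ i = d j * y $ j" "\<beta> j * y $ j = d i * y $ i"
    using xy(3)[of i] xy(3)[of j] assms by simp_all
  have sums: "x $ i + y $ i = 0" "x $ j + y $ j = 1"
    using arg_cong[OF xy(1), of "\<lambda>v. v $ i"] arg_cong[OF xy(1), of "\<lambda>v. v $ j"] assms(3)
    by (simp_all add: axis_def)
  have "\<beta> j * (1 - \<beta> i * \<beta> j) = 0"
    using x y(2) sums by algebra
  then have "\<beta> i * \<beta> j = 1"
    using \<beta>_nonzero[of j] by simp
  then have "(1 - d i * d j) * d j = 0"
    using x y sums by algebra
  then show ?thesis
    using d_nonzero[of j] by simp
qed

lemma no_long_cycle: "\<sigma> (\<sigma> i) = i"
proof (rule ccontr)
  assume long: "\<sigma> (\<sigma> i) \<noteq> i"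
  define j k where "j = \<sigma> i" and "k = \<sigma> j"
  have inj: "inj \<sigma>"
    using permutes by (rule permutes_inj)
  have "j \<noteq> i" and "k \<noteq> i"
    using long by (auto simp: j_def k_def)
  have "d k \<noteq> 1"
  proof
    assume "d k = 1"
    then have "\<sigma> k = \<sigma> j"
      using fixed_outside_support(1) by (simp add: k_def)
    then have "\<sigma> j = \<sigma> i"
      using inj by (simp add: inj_eq k_def j_def)
    then show False
      using inj \<open>j \<noteq> i\<close> by (simp add: inj_eq)
  qed
  obtain x y where xy: "axis i 1 = x + y" "\<And>l. x $ \<sigma> l = \<beta> l * x $ l"
      "\<And>l. \<beta> l * y $ l = d (\<sigma> l) * y $ \<sigma> l"
    using decomposition[of "axis i 1"] by blast
  have x: "x $ j = \<beta> i * x $ i" "x $ k = \<beta> j * x $ j"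
    using xy(2)[of i] xy(2)[of j] by (simp_all add: j_def k_def)
  have y: "\<beta> i * y $ i = d j * y $ j" "\<beta> j * y $ j = d k * y $ k"
    using xy(3)[of i] xy(3)[of j] by (simp_all add: j_def k_def)
  have sums: "x $ i + y $ i = 1" "x $ j + y $ j = 0" "x $ k + y $ k = 0"
    using arg_cong[OF xy(1), of "\<lambda>v. v $ i"] arg_cong[OF xy(1), of "\<lambda>v. v $ j"]
      arg_cong[OF xy(1), of "\<lambda>v. v $ k"] \<open>j \<noteq> i\<close> \<open>k \<noteq> i\<close>
    by (simp_all add: axis_def)
  have "\<beta> i * \<beta> i * \<beta> j * (1 - d k) = 0"
    using x y sums by algebra
  then show False
    using \<beta>_nonzero[of i] \<beta>_nonzero[of j] \<open>d k \<noteq> 1\<close> by simp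
qed

lemma moved_point:
  assumes "\<sigma> i \<noteq> i"
  shows "d i \<noteq> 1" and "d (\<sigma> i) \<noteq> 1" and "d i * d (\<sigma> i) = 1"
proof -
  show "d i \<noteq> 1" and "d (\<sigma> i) \<noteq> 1"
    using assms fixed_outside_support(1) no_long_cycle[of i] by metis+
  show "d i * d (\<sigma> i) = 1"
    using two_cycle[OF refl no_long_cycle] assms by simp
qed

lemma identity_permutation:
  assumes "\<sigma> = id"
  shows "\<beta> = (\<lambda>l. if l \<in> {l. \<beta> l \<noteq> 1} then d l else 1)" and "{l. \<beta> l \<noteq> 1} \<subseteq> {l. d l \<noteq> 1}"
proof -
  show "{l. \<beta> l \<noteq> 1} \<subseteq> {l. d l \<noteq> 1}"
    using fixed_outside_support(2) by blast
  have "\<beta> l = (if \<beta> l \<noteq> 1 then d l else 1)" for l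
    using fixed_point_entry[of l] assms by auto
  then show "\<beta> = (\<lambda>l. if l \<in> {l. \<beta> l \<noteq> 1} then d l else 1)"
    unfolding mem_Collect_eq by (rule ext)
qed

end

lemma p_connected_codim_atom:
  assumes "0 < m" and "p dvd m" and "g \<in> Gmpn m p" and "p_connected m p g"
    and "\<not> (codim g = 2 \<and> det g = 1)"
  shows "codim_atom (Gmpn m p) g"
proof -
  define d where "d l = g $ l $ l" for l
  define S where "S = {l. d l \<noteq> 1}"
  have g: "diagonal g" "g \<noteq> mat 1"
    using assms(4) by (auto simp: p_connected_def)
  have "\<exists>c. (\<forall>i\<in>S. d i = zeta m ^ c i) \<and> p dvd (\<Sum>i\<in>S. c i) \<and>
      (\<forall>I. I \<noteq> {} \<and> I \<subset> S \<longrightarrow> \<not> p dvd (\<Sum>i\<in>I. c i))"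
    using assms(4) by (simp add: p_connected_def Let_def S_def d_def)
  then obtain c where c: "\<forall>i\<in>S. d i = zeta m ^ c i"
      "\<forall>I. I \<noteq> {} \<and> I \<subset> S \<longrightarrow> \<not> p dvd (\<Sum>i\<in>I. c i)"
    by (elim exE conjE)
  note diag = diagonal_Gmpn[OF assms(3,1) g(1), folded d_def]
  have d_nonzero: "d l \<noteq> 0" for l
    using nonzero_if_power_eq_1[of "d l" m] diag(2) assms(1) by blast
  have dvd_iff: "(\<Prod>i\<in>I. d i) ^ (m div p) = 1 \<longleftrightarrow> p dvd (\<Sum>i\<in>I. c i)" if "I \<subseteq> S" for I
    by (rule prod_zeta_powers_power_div_eq_1_iff[OF assms(1,2)]) (use c(1) that in blast)
  show ?thesis
  proof (rule codim_atomI[OF assms(3) g(2)])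
    fix b assume b: "b \<in> Gmpn m p" "codim_le b g"
    then obtain \<sigma> \<beta> where \<beta>: "\<sigma> permutes UNIV" "b = monom \<sigma> \<beta>" "\<forall>j. \<beta> j ^ m = 1"
        "(\<Prod>j\<in>UNIV. \<beta> j) ^ (m div p) = 1"
      unfolding Gmpn_iff by blast
    interpret monomial_below_diagonal d \<beta> \<sigma>
    proof
      show "\<sigma> permutes UNIV"
        by (rule \<beta>(1))
      show "d l \<noteq> 0" for l
        by (rule d_nonzero)
      show "\<beta> l \<noteq> 0" for l
        using \<beta>(3) assms(1) nonzero_if_power_eq_1 by blast
      show "codim_le (monom \<sigma> \<beta>) (monom id d)"
        using b(2) \<beta>(2) diag(1) by simp
    qed
    show "b = mat 1 \<or> b = g"
    proof (cases "\<sigma> = id")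
      case True
      define T where "T = {l. \<beta> l \<noteq> 1}"
      note T = identity_permutation[OF True, folded T_def S_def]
      have "(\<Prod>l\<in>UNIV. \<beta> l) = (\<Prod>l\<in>T. d l)"
        by (subst T(1)) (simp add: prod.If_cases)
      then have "p dvd (\<Sum>l\<in>T. c l)"
        using \<beta>(4) dvd_iff[OF T(2)] by simp
      then have "T = {} \<or> T = S"
        using c(2)[rule_format, of T] T(2) by blast
      then show ?thesis
      proof
        assume "T = {}"
        then show ?thesis
          using T(1) True \<beta>(2) by (simp add: mat_1_eq_monom)
      next
        assume "T = S"
        then have "\<beta> = d"
          using T(1) by (auto simp: S_def fun_eq_iff)
        then show ?thesis
          using True \<beta>(2) diag(1) by simp
      qed
    next
      case False
      then have "\<exists>i. \<sigma> i \<noteq> i"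
        by (simp add: fun_eq_iff)
      then obtain i where i: "\<sigma> i \<noteq> i"
        by blast
      define j where "j = \<sigma> i"
      have "i \<noteq> j" and "d i \<noteq> 1" and "d j \<noteq> 1" and dij: "d i * d j = 1"
        using i moved_point[OF i] by (simp_all add: j_def)
      then have ij: "{i, j} \<subseteq> S"
        by (simp add: S_def)
      then have "p dvd (\<Sum>l\<in>{i, j}. c l)"
        using dvd_iff[OF ij] \<open>i \<noteq> j\<close> dij by simp
      then have S: "S = {i, j}"
        using c(2)[rule_format, of "{i, j}"] ij by blast
      then have "codim g = 2"
        using codim_diagonal[OF g(1)] \<open>i \<noteq> j\<close> by (simp add: S_def d_def)
      moreover have "det g = 1"
        using det_diagonal_matrix[OF g(1)] prod_UNIV_eq_prod_support[of d] S \<open>i \<noteq> j\<close> dij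
        by (simp add: S_def d_def)
      ultimately show ?thesis
        using assms(5) by simp
    qed
  qed
qed

theorem mainTheorem7:
  fixes m p :: nat
  assumes "0 < m" and "0 < p" and "p dvd m"
  shows "{a :: complex^'n^'n. codim_atom (Gmpn m p) a} =
         {g \<in> Gmpn m p. reflection g} \<union>
         {g \<in> Gmpn m p. p_connected m p g \<and> \<not> (codim g = 2 \<and> det g = 1)}"
proof (intro set_eqI iffI)
  fix a :: "complex^'n^'n"
  assume "a \<in> {a. codim_atom (Gmpn m p) a}"
  then show "a \<in> {g \<in> Gmpn m p. reflection g} \<union>
      {g \<in> Gmpn m p. p_connected m p g \<and> \<not> (codim g = 2 \<and> det g = 1)}"
    using codim_atom_Gmpn_cases[OF assms(1,3)] by (auto simp: codim_atom_def)
next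
  fix a :: "complex^'n^'n"
  assume "a \<in> {g \<in> Gmpn m p. reflection g} \<union>
      {g \<in> Gmpn m p. p_connected m p g \<and> \<not> (codim g = 2 \<and> det g = 1)}"
  then show "a \<in> {a. codim_atom (Gmpn m p) a}"
    using codim_1_codim_atom[OF _ _ reflection_codim_1] invertible_Gmpn[OF _ assms(1)]
      p_connected_codim_atom[OF assms(1,3)] by blast
qed

end
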